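(* Let $\Gamma$ be a finite, connected, simple, undirected graph with at least one edge and $m$ edges, $G$ a group, $s_2\in Z(G)$ with $s_2^2=1_G$, $H\in\mathcal H_\Gamma$, and $\pi$ a unitary representation of $G$ of degree $k$. Then $$\widehat{A_{L(\Gamma),\Psi_L(H)}}(\pi)=(I_m\otimes\pi(s_2))\bigl(\widehat H(\pi)^*\widehat H(\pi)-2I_{km}\bigr).$$
   Context: Fix orders $V_\Gamma=\{v_1,\dots,v_n\}$, $E_\Gamma=\{e_1,\dots,e_m\}$; write $v_i\in e_j$ if $v_i$ is an endpoint of $e_j$, and $e_i\cap e_j$ for the common endpoint of distinct edges sharing a vertex. $\mathbb CG$ is the complex group algebra of $G$. A $G$-phase of $\Gamma$ is $H\in M_{n\times m}(\mathbb CG)$ with $H_{i,j}\in G$ if $v_i\in e_j$ and $H_{i,j}=0$ otherwise; $\mathcal H_\Gamma$ is their set. The line graph $L(\Gamma)$ has vertex set $E_\Gamma$ (ordered $e_1,\dots,e_m$), $e_i\sim e_j$ iff they share an endpoint. $\Psi_L(H)$ is the $G$-gain function on $L(\Gamma)$ with $\Psi_L(H)(e_i,e_j)=s_2H_{k,i}^{-1}H_{k,j}$ for $v_k=e_i\cap e_j$; for a gain function $\zeta$ on $L(\Gamma)$, $A_{L(\Gamma),\zeta}\in M_m(\mathbb CG)$ has $(i,j)$ entry $\zeta(e_i,e_j)$ if $e_i\sim e_j$ and $0$ otherwise. A representation of degree $k$ is a homomorphism $\pi\colon G\to GL_k(\mathbb C)$, unitary if all $\pi(g)$ are unitary. For $A\in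 M_{p\times q}(\mathbb CG)$, $\widehat A(\pi)\in M_{pk\times qk}(\mathbb C)$ is the block matrix whose $(i,j)$ block is $\sum_x a_x\pi(x)$ where $A_{i,j}=\sum_x a_xx$ (so an entry $g\in G$ becomes $\pi(g)$ and $0$ becomes the zero block). $M^*$ is the conjugate transpose, and $\otimes$ the Kronecker product. *)

theory Defs
  imports
    "HOL-Library.Poly_Mapping"
    "HOL-Algebra.Group"
    "Graph_Theory.Graph_Theory"
    "Jordan_Normal_Form.Schur_Decomposition"
begin

text \<open>
  A finite simple undirected graph is a \<^locale>\<open>pair_graph\<close>: an edge joining u and v is
  represented there by the two arcs (u, v) and (v, u). Below, an edge is the set of its two endpoints.
\<close>

definition edge_set :: "'v pair_pre_digraph \<Rightarrow> 'v set set" where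
  "edge_set \<Gamma> = {{u, v} | u v. (u, v) \<in> parcs \<Gamma>}"

definition line_graph :: "'v pair_pre_digraph \<Rightarrow> 'v set pair_pre_digraph" where
  "line_graph \<Gamma> = \<lparr>pverts = edge_set \<Gamma>,
     parcs = {(e, f). e \<in> edge_set \<Gamma> \<and> f \<in> edge_set \<Gamma> \<and> e \<noteq> f \<and> e \<inter> f \<noteq> {}}\<rparr>"

text \<open>
  Orders \<open>v\<^sub>1,\<dots>,v\<^sub>n\<close> and \<open>e\<^sub>1,\<dots>,e\<^sub>m\<close> are bijective enumerations of the vertices and edges,
  with indices starting at 0.
\<close>

definition enumerates :: "nat \<Rightarrow> (nat \<Rightarrow> 'a) \<Rightarrow> 'a set \<Rightarrow> bool" where
  "enumerates n x X \<longleftrightarrow> bij_betw x {..<n} X"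

text \<open>
  The elements of the complex group algebra of G are the finitely supported functions
  with values in \<^typ>\<open>complex\<close> and support in the carrier of G, represented in
  \<open>'g \<Rightarrow>\<^sub>0 complex\<close>; \<open>of_group g\<close> is the basis element g, and \<open>to_group G\<close> inverts this
  embedding on its image.
\<close>

definition of_group :: "'g \<Rightarrow> 'g \<Rightarrow>\<^sub>0 complex" where
  "of_group g = Poly_Mapping.single g 1"

definition to_group :: "('g, 'b) monoid_scheme \<Rightarrow> ('g \<Rightarrow>\<^sub>0 complex) \<Rightarrow> 'g" where
  "to_group G a = (THE g. g \<in> carrier G \<and> a = of_group g)"

definition phases ::
  "('g, 'b) monoid_scheme \<Rightarrow> nat \<Rightarrow> nat \<Rightarrow> (nat \<Rightarrow> 'v) \<Rightarrow> (nat \<Rightarrow> 'v set) \<Rightarrow> ('g \<Rightarrow>\<^sub>0 complex) mat set"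
  where
  "phases G n m v e = {H \<in> carrier_mat n m. \<forall>i<n. \<forall>j<m.
     if v i \<in> e j then H $$ (i, j) \<in> of_group ` carrier G else H $$ (i, j) = 0}"

text \<open>
  On adjacent edges a and b with \<open>a = e\<^sub>i\<close>, \<open>b = e\<^sub>j\<close> and common endpoint \<open>v\<^sub>k\<close>,
  the value is \<open>s\<^sub>2 H\<^sub>k\<^sub>i\<^sup>-\<^sup>1 H\<^sub>k\<^sub>j\<close>; it is irrelevant on other pairs.
\<close>

definition line_gain ::
  "('g, 'b) monoid_scheme \<Rightarrow> 'g \<Rightarrow> nat \<Rightarrow> nat \<Rightarrow> (nat \<Rightarrow> 'v) \<Rightarrow> (nat \<Rightarrow> 'v set)
     \<Rightarrow> ('g \<Rightarrow>\<^sub>0 complex) mat \<Rightarrow> 'v set \<times> 'v set \<Rightarrow> 'g" where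
  "line_gain G s n m v e H = (\<lambda>(a, b).
     let i = (THE i. i < m \<and> e i = a);
         j = (THE j. j < m \<and> e j = b);
         k = (THE k. k < n \<and> a \<inter> b = {v k})
     in s \<otimes>\<^bsub>G\<^esub> inv\<^bsub>G\<^esub> (to_group G (H $$ (k, i))) \<otimes>\<^bsub>G\<^esub> to_group G (H $$ (k, j)))"

definition gain_adjacency ::
  "'w pair_pre_digraph \<Rightarrow> nat \<Rightarrow> (nat \<Rightarrow> 'w) \<Rightarrow> ('w \<times> 'w \<Rightarrow> 'g) \<Rightarrow> ('g \<Rightarrow>\<^sub>0 complex) mat" where
  "gain_adjacency \<Lambda> m w \<zeta> = mat m m (\<lambda>(i, j).
     if (w i, w j) \<in> parcs \<Lambda> then of_group (\<zeta> (w i, w j)) else 0)"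

definition general_linear_group :: "nat \<Rightarrow> complex mat monoid" where
  "general_linear_group k = units_of (ring_mat TYPE(complex) k ())"

definition representation :: "('g, 'b) monoid_scheme \<Rightarrow> nat \<Rightarrow> ('g \<Rightarrow> complex mat) \<Rightarrow> bool" where
  "representation G k \<pi> \<longleftrightarrow> \<pi> \<in> hom G (general_linear_group k)"

definition unitary_mat :: "nat \<Rightarrow> complex mat \<Rightarrow> bool" where
  "unitary_mat k U \<longleftrightarrow> U \<in> carrier_mat k k \<and> mat_adjoint U * U = 1\<^sub>m k \<and> U * mat_adjoint U = 1\<^sub>m k"

definition unitary_representation ::
  "('g, 'b) monoid_scheme \<Rightarrow> nat \<Rightarrow> ('g \<Rightarrow> complex mat) \<Rightarrow> bool" where
  "unitary_representation G k \<pi> \<longleftrightarrow>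
     representation G k \<pi> \<and> (\<forall>g \<in> carrier G. unitary_mat k (\<pi> g))"

definition fourier_elem :: "nat \<Rightarrow> ('g \<Rightarrow> complex mat) \<Rightarrow> ('g \<Rightarrow>\<^sub>0 complex) \<Rightarrow> complex mat" where
  "fourier_elem k \<pi> a = mat k k (\<lambda>(r, c).
     \<Sum>x \<in> Poly_Mapping.keys a. Poly_Mapping.lookup a x * \<pi> x $$ (r, c))"

definition fourier_mat ::
  "nat \<Rightarrow> ('g \<Rightarrow> complex mat) \<Rightarrow> ('g \<Rightarrow>\<^sub>0 complex) mat \<Rightarrow> complex mat" where
  "fourier_mat k \<pi> A = mat (dim_row A * k) (dim_col A * k) (\<lambda>(r, c).
     fourier_elem k \<pi> (A $$ (r div k, c div k)) $$ (r mod k, c mod k))"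

definition kronecker_product :: "'a::times mat \<Rightarrow> 'a mat \<Rightarrow> 'a mat" where
  "kronecker_product A B = mat (dim_row A * dim_row B) (dim_col A * dim_col B) (\<lambda>(r, c).
     A $$ (r div dim_row B, c div dim_col B) * B $$ (r mod dim_row B, c mod dim_col B))"

end

theory Submission
  imports Defs
begin

text \<open>
  Compare the two sides block by block. If \<open>F\<close> is the Fourier transform of \<open>H\<close>, then the
  \<open>(i, j)\<close> block of \<open>F\<^sup>*F\<close> is the sum over the common endpoints \<open>v\<^sub>l\<close> of \<open>e\<^sub>i\<close> and \<open>e\<^sub>j\<close> of
  \<open>\<pi>(H\<^sub>l\<^sub>i)\<^sup>*\<pi>(H\<^sub>l\<^sub>j) = \<pi>(H\<^sub>l\<^sub>i\<^sup>-\<^sup>1H\<^sub>l\<^sub>j)\<close>. On the diagonal there are two of them, each contributing the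
  identity; off the diagonal there is one if the edges are adjacent and none otherwise.
\<close>

section \<open>Matrices cut into square blocks of size \<open>k\<close>\<close>

definition block :: "nat \<Rightarrow> 'a mat \<Rightarrow> nat \<Rightarrow> nat \<Rightarrow> 'a mat" where
  "block k A i j = mat k k (\<lambda>(a, b). A $$ (i * k + a, j * k + b))"

lemma dim_block [simp]: "dim_row (block k A i j) = k" "dim_col (block k A i j) = k"
  by (simp_all add: block_def)

lemma index_block [simp]:
  "a < k \<Longrightarrow> b < k \<Longrightarrow> block k A i j $$ (a, b) = A $$ (i * k + a, j * k + b)"
  by (simp add: block_def)

lemma block_index_less:
  fixes i a k p :: nat
  assumes "i < p" "a < k"
  shows "i * k + a < p * k"
proof -
  have "i * k + a < Suc i * k" using assms by simp
  also have "\<dots> \<le> p * k" using assms by (intro mult_right_mono) auto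
  finally show ?thesis .
qed

text \<open>Every index \<open>r\<close> equals \<open>(r div k) * k + r mod k\<close>, so each
  entry of the matrix lies in exactly one block.\<close>

lemma eq_mat_blockI:
  assumes A: "A \<in> carrier_mat (p * k) (q * k)" and B: "B \<in> carrier_mat (p * k) (q * k)"
    and eq: "\<And>i j. i < p \<Longrightarrow> j < q \<Longrightarrow> block k A i j = block k B i j"
  shows "A = B"
proof (rule eq_matI)
  fix r c assume "r < dim_row B" "c < dim_col B"
  then have r: "r < p * k" and c: "c < q * k" using B by auto
  \<comment> \<open>For degree \<open>k = 0\<close> there is no index below \<open>p * k\<close>,
    hence nothing to compare.\<close>
  then have k: "k > 0" by (cases k) auto
  have "block k A (r div k) (c div k) $$ (r mod k, c mod k) =
        block k B (r div k) (c div k) $$ (r mod k, c mod k)"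
    using eq r c by (simp add: less_mult_imp_div_less)
  then show "A $$ (r, c) = B $$ (r, c)"
    using k by simp
qed (use A B in auto)

text \<open>The summation range of length \<open>q * k\<close> in a scalar product splits into
  \<open>q\<close> consecutive intervals of length \<open>k\<close>, and the \<open>l\<close>-th
  interval is a scalar product inside the \<open>l\<close>-th pair of blocks. The claim is entrywise
  because matrices of all sizes share one type, with no common zero from which to sum.\<close>

lemma block_mult_index:
  fixes A B :: "'a::semiring_0 mat"
  assumes A: "A \<in> carrier_mat (p * k) (q * k)" and B: "B \<in> carrier_mat (q * k) (r * k)"
    and ij: "i < p" "j < r" and ab: "a < k" "b < k"
  shows "block k (A * B) i j $$ (a, b) = (\<Sum>l<q. (block k A i l * block k B l j) $$ (a, b))"
proof -
  let ?f = "\<lambda>t. A $$ (i * k + a, t) * B $$ (t, j * k + b)"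
  have "block k (A * B) i j $$ (a, b) = sum ?f {..<q * k}"
    using A B ab block_index_less[OF ij(1) ab(1)] block_index_less[OF ij(2) ab(2)]
    by (simp add: scalar_prod_def atLeast0LessThan)
  also have "\<dots> = (\<Sum>l<q. sum ?f {l * k..<l * k + k})"
    by (rule sum.nat_group[symmetric])
  also have "\<dots> = (\<Sum>l<q. (block k A i l * block k B l j) $$ (a, b))"
  proof (rule sum.cong[OF refl])
    fix l assume "l \<in> {..<q}"
    have "sum ?f {l * k..<l * k + k} = (\<Sum>t = 0..<k. ?f (t + l * k))"
      using sum.shift_bounds_nat_ivl[of ?f 0 "l * k" k] by (simp add: add.commute)
    then show "sum ?f {l * k..<l * k + k} = (block k A i l * block k B l j) $$ (a, b)"
      using ab by (simp add: scalar_prod_def add.commute)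
  qed
  finally show ?thesis .
qed

lemma block_minus:
  assumes "A \<in> carrier_mat (p * k) (q * k)" "B \<in> carrier_mat (p * k) (q * k)" "i < p" "j < q"
  shows "block k (A - B) i j = block k A i j - block k B i j"
  using assms by (intro eq_matI) (auto simp: block_index_less)

lemma block_smult:
  assumes "A \<in> carrier_mat (p * k) (q * k)" "i < p" "j < q"
  shows "block k (c \<cdot>\<^sub>m A) i j = c \<cdot>\<^sub>m block k A i j"
  using assms by (intro eq_matI) (auto simp: block_index_less)

text \<open>Uniqueness of quotient and remainder on division by \<open>k\<close>. It locates the
  ones of a large identity matrix within its blocks.\<close>

lemma block_index_eq_iff:
  fixes a b i j k :: nat
  assumes "a < k" "b < k"
  shows "i * k + a = j * k + b \<longleftrightarrow> i = j \<and> a = b"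
proof
  assume eq: "i * k + a = j * k + b"
  then have "(i * k + a) div k = (j * k + b) div k" "(i * k + a) mod k = (j * k + b) mod k"
    by simp_all
  then show "i = j \<and> a = b" using assms by simp
qed simp

lemma block_one:
  assumes "i < p" "j < p"
  shows "block k (1\<^sub>m (p * k)) i j = (if i = j then 1\<^sub>m k else 0\<^sub>m k k)"
  using assms by (intro eq_matI) (auto simp: block_index_less block_index_eq_iff)

section \<open>Adjoints and Kronecker products, block by block\<close>

lemma mat_adjoint_index [simp]:
  "r < dim_col A \<Longrightarrow> c < dim_row A \<Longrightarrow> mat_adjoint A $$ (r, c) = conjugate (A $$ (c, r))"
  by (simp add: mat_adjoint_def mat_of_rows_def)

lemma mat_adjoint_dim [simp]:
  "dim_row (mat_adjoint A) = dim_col A" "dim_col (mat_adjoint A) = dim_row A"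
  by (simp_all add: mat_adjoint_def mat_of_rows_def)

lemma block_mat_adjoint:
  assumes "A \<in> carrier_mat (p * k) (q * k)" "i < q" "j < p"
  shows "block k (mat_adjoint A) i j = mat_adjoint (block k A j i)"
  using assms by (intro eq_matI) (auto simp: block_index_less)

lemma mat_adjoint_zero [simp]: "mat_adjoint (0\<^sub>m k l :: complex mat) = 0\<^sub>m l k"
  by (intro eq_matI) auto

lemma block_kronecker_product:
  assumes "A \<in> carrier_mat p q" "B \<in> carrier_mat k k" "i < p" "j < q"
  shows "block k (kronecker_product A B) i j = A $$ (i, j) \<cdot>\<^sub>m B"
  using assms by (intro eq_matI) (auto simp: block_index_less kronecker_product_def)

lemma kronecker_product_carrier:
  "A \<in> carrier_mat p q \<Longrightarrow> B \<in> carrier_mat r s \<Longrightarrow>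
    kronecker_product A B \<in> carrier_mat (p * r) (q * s)"
  by (auto simp: kronecker_product_def)

text \<open>The Kronecker product is block diagonal with copies of \<open>B\<close> on the diagonal,
  so in the block product only the term \<open>l = i\<close> survives.\<close>

lemma block_kronecker_one_mult:
  fixes B X :: "'a::comm_semiring_1 mat"
  assumes B: "B \<in> carrier_mat k k" and X: "X \<in> carrier_mat (m * k) (q * k)"
    and ij: "i < m" "j < q"
  shows "block k (kronecker_product (1\<^sub>m m) B * X) i j = B * block k X i j"
proof (rule eq_matI)
  fix a b assume "a < dim_row (B * block k X i j)" "b < dim_col (B * block k X i j)"
  then have ab: "a < k" "b < k" using B by auto
  have "block k (kronecker_product (1\<^sub>m m) B * X) i j $$ (a, b) =
      (\<Sum>l<m. (block k (kronecker_product (1\<^sub>m m) B) i l * block k X l j) $$ (a, b))"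
    using kronecker_product_carrier[OF one_carrier_mat B] X ij ab by (rule block_mult_index)
  also have "\<dots> = (\<Sum>l<m. if l = i then (B * block k X i j) $$ (a, b) else 0)"
  proof (rule sum.cong[OF refl])
    fix l assume "l \<in> {..<m}"
    then have "block k (kronecker_product (1\<^sub>m m) B) i l = (1\<^sub>m m $$ (i, l)) \<cdot>\<^sub>m B"
      using B ij by (intro block_kronecker_product) auto
    then show "(block k (kronecker_product (1\<^sub>m m) B) i l * block k X l j) $$ (a, b) =
        (if l = i then (B * block k X i j) $$ (a, b) else 0)"
      using B ij ab \<open>l \<in> {..<m}\<close> by (auto simp: scalar_prod_def)
  qed
  also have "\<dots> = (B * block k X i j) $$ (a, b)" using ij by simp
  finally show "block k (kronecker_product (1\<^sub>m m) B * X) i j $$ (a, b) =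
      (B * block k X i j) $$ (a, b)" .
qed (use B in auto)

section \<open>Fourier transforms and group elements inside the group algebra\<close>

lemma fourier_elem_zero [simp]: "fourier_elem k \<pi> 0 = 0\<^sub>m k k"
  by (intro eq_matI) (auto simp: fourier_elem_def)

lemma fourier_elem_of_group:
  "\<pi> g \<in> carrier_mat k k \<Longrightarrow> fourier_elem k \<pi> (of_group g) = \<pi> g"
  by (intro eq_matI) (auto simp: fourier_elem_def of_group_def)

lemma block_fourier_mat:
  assumes "A \<in> carrier_mat p q" "i < p" "j < q"
  shows "block k (fourier_mat k \<pi> A) i j = fourier_elem k \<pi> (A $$ (i, j))"
  using assms
  by (intro eq_matI) (auto simp: block_index_less fourier_mat_def fourier_elem_def)

lemma fourier_mat_carrier:
  "A \<in> carrier_mat p q \<Longrightarrow> fourier_mat k \<pi> A \<in> carrier_mat (p * k) (q * k)"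
  by (auto simp: fourier_mat_def)

text \<open>The coefficient 1 is nonzero, so the support of a basis element is a singleton and
  determines the group element.\<close>

lemma of_group_eq_iff [simp]: "of_group g = of_group h \<longleftrightarrow> g = h"
proof
  assume "of_group g = of_group h"
  then have "Poly_Mapping.keys (of_group g) = Poly_Mapping.keys (of_group h)" by simp
  then show "g = h" by (simp add: of_group_def)
qed simp

lemma to_group_of_group: "g \<in> carrier G \<Longrightarrow> to_group G (of_group g) = g"
  unfolding to_group_def by (rule the_equality) auto

text \<open>At incident positions a phase has basis elements as entries, so one may pass to the
  group and back without loss.\<close>

lemma phases_to_group:
  assumes "H \<in> phases G n m v e" "l < n" "j < m" "v l \<in> e j"
  shows "to_group G (H $$ (l, j)) \<in> carrier G"
    and "of_group (to_group G (H $$ (l, j))) = H $$ (l, j)"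
proof -
  obtain g where "g \<in> carrier G" "H $$ (l, j) = of_group g"
    using assms unfolding phases_def by force
  then show "to_group G (H $$ (l, j)) \<in> carrier G"
    and "of_group (to_group G (H $$ (l, j))) = H $$ (l, j)"
    by (simp_all add: to_group_of_group)
qed

section \<open>Unitary representations\<close>

lemma unitary_representation_carrier:
  "unitary_representation G k \<pi> \<Longrightarrow> g \<in> carrier G \<Longrightarrow> \<pi> g \<in> carrier_mat k k"
  by (simp add: unitary_representation_def unitary_mat_def)

lemma unitary_representation_mult:
  assumes "unitary_representation G k \<pi>" "g \<in> carrier G" "h \<in> carrier G"
  shows "\<pi> (g \<otimes>\<^bsub>G\<^esub> h) = \<pi> g * \<pi> h"
  using assms
  by (simp add: unitary_representation_def representation_def hom_def general_linear_group_def
      units_of_def ring_mat_def)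

text \<open>Write \<open>h\<close> as \<open>g\<close> times \<open>?x\<close>. Then
  \<open>\<pi> h\<close> is \<open>\<pi> g * \<pi> ?x\<close>, and unitarity cancels
  \<open>\<pi> g\<close> against its adjoint. The value of \<pi> at the inverse of \<open>g\<close>
  is never computed.\<close>

lemma unitary_representation_adjoint_mult:
  assumes "group G" and \<pi>: "unitary_representation G k \<pi>"
    and g: "g \<in> carrier G" and h: "h \<in> carrier G"
  shows "mat_adjoint (\<pi> g) * \<pi> h = \<pi> (inv\<^bsub>G\<^esub> g \<otimes>\<^bsub>G\<^esub> h)"
proof -
  interpret group G by fact
  let ?x = "inv\<^bsub>G\<^esub> g \<otimes>\<^bsub>G\<^esub> h"
  have x: "?x \<in> carrier G" using g h by simp
  have U: "mat_adjoint (\<pi> g) * \<pi> g = 1\<^sub>m k" "\<pi> g \<in> carrier_mat k k"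
    using \<pi> g by (auto simp: unitary_representation_def unitary_mat_def)
  have "g \<otimes>\<^bsub>G\<^esub> ?x = h" using g h by (simp add: m_assoc[symmetric])
  then have "\<pi> h = \<pi> g * \<pi> ?x"
    using unitary_representation_mult[OF \<pi> g x] by simp
  then have "mat_adjoint (\<pi> g) * \<pi> h = mat_adjoint (\<pi> g) * \<pi> g * \<pi> ?x"
    using assoc_mult_mat[OF _ U(2) unitary_representation_carrier[OF \<pi> x]]
    by (metis U(2) carrier_matD carrier_matI mat_adjoint_dim)
  also have "\<dots> = \<pi> ?x" using U unitary_representation_carrier[OF \<pi> x] by simp
  finally show ?thesis .
qed

section \<open>Edges as two-element sets, and their enumerations\<close>

lemma edge_setE:
  assumes "pair_graph \<Gamma>" "a \<in> edge_set \<Gamma>"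
  obtains u w where "a = {u, w}" "u \<noteq> w" "u \<in> pverts \<Gamma>" "w \<in> pverts \<Gamma>"
proof -
  interpret pair_graph \<Gamma> by fact
  obtain u w where uw: "a = {u, w}" "(u, w) \<in> parcs \<Gamma>" using assms by (auto simp: edge_set_def)
  then show thesis using that[of u w] no_loops'[of u w] in_arcsD1 in_arcsD2 by auto
qed

lemma edge_subset_pverts:
  "pair_graph \<Gamma> \<Longrightarrow> a \<in> edge_set \<Gamma> \<Longrightarrow> a \<subseteq> pverts \<Gamma>"
  by (auto elim: edge_setE)

lemma card_edge:
  "pair_graph \<Gamma> \<Longrightarrow> a \<in> edge_set \<Gamma> \<Longrightarrow> card a = 2"
  by (auto elim: edge_setE)

text \<open>Two-element sets with two common elements coincide. Hence the common endpoint used in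
  \<open>line_gain\<close> is unique.\<close>

lemma edge_inter_singleton:
  assumes "pair_graph \<Gamma>" "a \<in> edge_set \<Gamma>" "b \<in> edge_set \<Gamma>" "a \<noteq> b" "x \<in> a" "x \<in> b"
  shows "a \<inter> b = {x}"
  using assms(2-) by (auto elim!: edge_setE[OF assms(1)])

text \<open>Evaluates the descriptions in \<open>line_gain\<close> that recover an index from its
  edge.\<close>

lemma the_enumerates:
  "enumerates n x X \<Longrightarrow> i < n \<Longrightarrow> (THE l. l < n \<and> x l = x i) = i"
  unfolding enumerates_def bij_betw_def inj_on_def by (intro the_equality) auto

text \<open>The enumeration restricts to a bijection onto \<open>A\<close>. Applied to an edge, it
  counts the indices of its endpoints.\<close>

lemma card_enumerates_vimage:
  assumes "enumerates n x X" "A \<subseteq> X"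
  shows "card {l. l < n \<and> x l \<in> A} = card A"
proof (rule bij_betw_same_card)
  have "x ` {l. l < n \<and> x l \<in> A} = A"
    using assms unfolding enumerates_def bij_betw_def by auto
  then show "bij_betw x {l. l < n \<and> x l \<in> A} A"
    using assms(1) unfolding enumerates_def bij_betw_def by (auto intro: inj_on_subset)
qed

section \<open>Blockwise comparison of the two sides\<close>

theorem theorem5p4:
  fixes \<Gamma> :: "'v pair_pre_digraph"
    and G :: "('g, 'b) monoid_scheme"
    and n m k :: nat
    and v :: "nat \<Rightarrow> 'v"
    and e :: "nat \<Rightarrow> 'v set"
    and s\<^sub>2 :: 'g
    and H :: "('g \<Rightarrow>\<^sub>0 complex) mat"
    and \<pi> :: "'g \<Rightarrow> complex mat"
  assumes "pair_graph \<Gamma>"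
    and "Digraph_Component.connected (with_proj \<Gamma>)"
    and "edge_set \<Gamma> \<noteq> {}"
    and "enumerates n v (pverts \<Gamma>)"
    and "enumerates m e (edge_set \<Gamma>)"
    and "group G"
    and "s\<^sub>2 \<in> carrier G"
    and "\<And>g. g \<in> carrier G \<Longrightarrow> s\<^sub>2 \<otimes>\<^bsub>G\<^esub> g = g \<otimes>\<^bsub>G\<^esub> s\<^sub>2"
    and "s\<^sub>2 \<otimes>\<^bsub>G\<^esub> s\<^sub>2 = \<one>\<^bsub>G\<^esub>"
    and "H \<in> phases G n m v e"
    and "unitary_representation G k \<pi>"
  shows "fourier_mat k \<pi> (gain_adjacency (line_graph \<Gamma>) m e (line_gain G s\<^sub>2 n m v e H)) =
    kronecker_product (1\<^sub>m m) (\<pi> s\<^sub>2) *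
      (mat_adjoint (fourier_mat k \<pi> H) * fourier_mat k \<pi> H - 2 \<cdot>\<^sub>m 1\<^sub>m (k * m))"
proof -
  interpret group G by fact
  note \<pi> = \<open>unitary_representation G k \<pi>\<close>
  note \<pi>_carrier = unitary_representation_carrier[OF \<pi>]
  define h where "h l j = to_group G (H $$ (l, j))" for l j
  define F where "F = fourier_mat k \<pi> H"
  define A where "A = gain_adjacency (line_graph \<Gamma>) m e (line_gain G s\<^sub>2 n m v e H)"
  \<comment> \<open>The size is written \<open>m * k\<close> to match the block lemmas; the order
    \<open>k * m\<close> of the claim is restored at the very end.\<close>
  define X where "X = mat_adjoint F * F - 2 \<cdot>\<^sub>m 1\<^sub>m (m * k)"
  have H: "H \<in> carrier_mat n m" using assms(10) by (simp add: phases_def)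
  have F: "F \<in> carrier_mat (n * k) (m * k)"
    unfolding F_def by (rule fourier_mat_carrier[OF H])
  have F': "mat_adjoint F \<in> carrier_mat (m * k) (n * k)" using F by auto
  have X: "X \<in> carrier_mat (m * k) (m * k)" using F F' by (auto simp: X_def)
  have A: "A \<in> carrier_mat m m" by (simp add: A_def gain_adjacency_def)
  have e: "e i \<in> edge_set \<Gamma>" if "i < m" for i
    using assms(5) that by (auto simp: enumerates_def bij_betw_def)
  have h: "h l j \<in> carrier G" if "l < n" "j < m" "v l \<in> e j" for l j
    unfolding h_def by (rule phases_to_group[OF assms(10) that])
  have block_F: "block k F l j = (if v l \<in> e j then \<pi> (h l j) else 0\<^sub>m k k)"
    if lj: "l < n" "j < m" for l j
  proof (cases "v l \<in> e j")
    case True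
    then have "H $$ (l, j) = of_group (h l j)"
      using phases_to_group[OF assms(10) lj] by (simp add: h_def)
    then show ?thesis
      using True block_fourier_mat[OF H lj, of k \<pi>] fourier_elem_of_group \<pi>_carrier[OF h[OF lj]]
      by (simp add: F_def)
  next
    case False
    then have "H $$ (l, j) = 0" using assms(10) lj by (auto simp: phases_def)
    then show ?thesis using False block_fourier_mat[OF H lj, of k \<pi>] by (simp add: F_def)
  qed
  have gram: "block k (mat_adjoint F * F) i j $$ (a, b) =
      (\<Sum>l \<in> {l. l < n \<and> v l \<in> e i \<inter> e j}. \<pi> (inv\<^bsub>G\<^esub> h l i \<otimes>\<^bsub>G\<^esub> h l j) $$ (a, b))"
    if ij: "i < m" "j < m" and ab: "a < k" "b < k" for i j a b
  proof -
    have "block k (mat_adjoint F * F) i j $$ (a, b) =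
        (\<Sum>l<n. (mat_adjoint (block k F l i) * block k F l j) $$ (a, b))"
      using block_mult_index[OF F' F ij ab] block_mat_adjoint[OF F ij(1)] by simp
    also have "\<dots> = (\<Sum>l<n. if v l \<in> e i \<inter> e j
        then \<pi> (inv\<^bsub>G\<^esub> h l i \<otimes>\<^bsub>G\<^esub> h l j) $$ (a, b) else 0)"
    proof (rule sum.cong[OF refl])
      fix l assume "l \<in> {..<n}"
      then have l: "l < n" by simp
      show "(mat_adjoint (block k F l i) * block k F l j) $$ (a, b) =
          (if v l \<in> e i \<inter> e j then \<pi> (inv\<^bsub>G\<^esub> h l i \<otimes>\<^bsub>G\<^esub> h l j) $$ (a, b) else 0)"
      proof (cases "v l \<in> e i \<inter> e j")
        case True
        then show ?thesis
          using l ij h unitary_representation_adjoint_mult[OF assms(6) \<pi>] by (simp add: block_F)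
      next
        case False
        have "mat_adjoint (block k F l i) \<in> carrier_mat k k" "block k F l j \<in> carrier_mat k k"
          by (auto intro: carrier_matI)
        \<comment> \<open>A vertex missing from one of the two edges gives a zero factor.\<close>
        moreover have "mat_adjoint (block k F l i) = 0\<^sub>m k k \<or> block k F l j = 0\<^sub>m k k"
          using False l ij by (auto simp: block_F)
        ultimately have "mat_adjoint (block k F l i) * block k F l j = 0\<^sub>m k k"
          by (metis left_mult_zero_mat right_mult_zero_mat)
        then show ?thesis using False ab by auto
      qed
    qed
    also have "\<dots> = (\<Sum>l \<in> {l. l < n \<and> v l \<in> e i \<inter> e j}.
        \<pi> (inv\<^bsub>G\<^esub> h l i \<otimes>\<^bsub>G\<^esub> h l j) $$ (a, b))"
      by (intro sum.mono_neutral_cong_right) auto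
    finally show ?thesis .
  qed
  have block_X: "block k X i j =
      block k (mat_adjoint F * F) i j - 2 \<cdot>\<^sub>m (if i = j then 1\<^sub>m k else 0\<^sub>m k k)"
    if ij: "i < m" "j < m" for i j
    unfolding X_def using F F' ij
    by (subst block_minus[of _ m k m], simp, simp, simp, simp,
        subst block_smult[of _ m k m], simp_all add: block_one)
  \<comment> \<open>For \<open>g = h = \<one>\<close> the adjoint product is \<pi> at the identity,
    and by unitarity it is the identity matrix.\<close>
  have one: "\<pi> \<one>\<^bsub>G\<^esub> = 1\<^sub>m k"
    using unitary_representation_adjoint_mult[OF assms(6) \<pi>, of "\<one>\<^bsub>G\<^esub>" "\<one>\<^bsub>G\<^esub>"] \<pi>
    by (simp add: unitary_representation_def unitary_mat_def)
  have blocks: "block k (fourier_mat k \<pi> A) i j = \<pi> s\<^sub>2 * block k X i j" if ij: "i < m" "j < m" for i j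
  proof -
    have block_A: "block k (fourier_mat k \<pi> A) i j = fourier_elem k \<pi> (A $$ (i, j))"
      by (rule block_fourier_mat[OF A ij])
    have s: "\<pi> s\<^sub>2 \<in> carrier_mat k k" by (rule \<pi>_carrier[OF assms(7)])
    have e_eq: "e i = e j \<longleftrightarrow> i = j"
      using assms(5) ij by (auto simp: enumerates_def bij_betw_def inj_on_def)
    show ?thesis
    \<comment> \<open>The negative case comprises the diagonal, since the line graph has no loops,
      and the pairs of disjoint edges. There both sides vanish.\<close>
    proof (cases "(e i, e j) \<in> parcs (line_graph \<Gamma>)")
      case True
      then have ne: "e i \<noteq> e j" and "e i \<inter> e j \<noteq> {}" by (auto simp: line_graph_def)
      then obtain x where x: "x \<in> e i" "x \<in> e j" by auto
      then have "x \<in> v ` {..<n}"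
        using edge_subset_pverts[OF assms(1) e[OF ij(1)]] assms(4)
        by (auto simp: enumerates_def bij_betw_def)
      then obtain l where l: "l < n" "x = v l" by auto
      have common: "e i \<inter> e j = {v l}"
        using edge_inter_singleton[OF assms(1) e[OF ij(1)] e[OF ij(2)] ne x] l by simp
      have index: "p = l" if "p < n" "v p = v l" for p
        using assms(4) l that by (auto simp: enumerates_def bij_betw_def inj_on_def)
      have "(THE p. p < n \<and> e i \<inter> e j = {v p}) = l"
        using l common index by (intro the_equality) auto
      then have gain: "A $$ (i, j) = of_group (s\<^sub>2 \<otimes>\<^bsub>G\<^esub> inv\<^bsub>G\<^esub> h l i \<otimes>\<^bsub>G\<^esub> h l j)"
        using True ij the_enumerates[OF assms(5)]
        by (simp add: A_def gain_adjacency_def line_gain_def Let_def h_def)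
      have hi: "h l i \<in> carrier G" and hj: "h l j \<in> carrier G"
        using h l ij x by auto
      \<comment> \<open>A single common endpoint leaves one summand in \<open>gram\<close>, and
        \<open>i \<noteq> j\<close> removes the multiple of the identity.\<close>
      have "{p. p < n \<and> v p \<in> e i \<inter> e j} = {l}"
        unfolding common using l index by auto
      then have "block k X i j = \<pi> (inv\<^bsub>G\<^esub> h l i \<otimes>\<^bsub>G\<^esub> h l j)"
        using ij ne \<pi>_carrier[of "inv\<^bsub>G\<^esub> h l i \<otimes>\<^bsub>G\<^esub> h l j"] hi hj gram[OF ij]
        by (intro eq_matI) (auto simp: block_X simp del: index_block)
      \<comment> \<open>Reassociating moves \<open>s\<^sub>2\<close> to the front, where
        multiplicativity of \<pi> splits it off as the left factor.\<close>
      moreover have "fourier_elem k \<pi> (A $$ (i, j)) =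
          \<pi> (s\<^sub>2 \<otimes>\<^bsub>G\<^esub> (inv\<^bsub>G\<^esub> h l i \<otimes>\<^bsub>G\<^esub> h l j))"
        unfolding gain using hi hj assms(7) by (simp add: fourier_elem_of_group \<pi>_carrier m_assoc)
      ultimately show ?thesis
        using block_A unitary_representation_mult[OF \<pi> assms(7)] hi hj by simp
    next
      case False
      then have "A $$ (i, j) = 0" using ij by (simp add: A_def gain_adjacency_def)
      moreover have "block k X i j = 0\<^sub>m k k"
      proof (cases "i = j")
        case True
        have card: "card {l. l < n \<and> v l \<in> e i} = 2"
          using card_enumerates_vimage[OF assms(4) edge_subset_pverts] card_edge e[OF ij(1)] assms(1)
          by metis
        \<comment> \<open>Each of the two endpoints contributes \<open>\<pi> \<one>\<close>, so the
          block is exactly the term that \<open>X\<close> subtracts.\<close>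
        have "block k (mat_adjoint F * F) i i $$ (a, b) = 2 * 1\<^sub>m k $$ (a, b)"
          if "a < k" "b < k" for a b
        proof -
          have "block k (mat_adjoint F * F) i i $$ (a, b) =
              (\<Sum>l \<in> {l. l < n \<and> v l \<in> e i}. 1\<^sub>m k $$ (a, b))"
            using gram[OF ij(1) ij(1) that] ij h by (simp add: one)
          then show ?thesis by (simp add: card)
        qed
        then show ?thesis using True ij
          by (intro eq_matI) (auto simp: block_X simp del: index_block)
      next
        case ne: False
        \<comment> \<open>Distinct indices give distinct edges, so failing to be adjacent means
          being disjoint; the sum in \<open>gram\<close> is then empty.\<close>
        then have "e i \<inter> e j = {}" using False e ij e_eq by (auto simp: line_graph_def)
        then show ?thesis using ne ij gram[OF ij]
          by (intro eq_matI) (auto simp: block_X simp del: index_block)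
      qed
      ultimately show ?thesis using block_A s by simp
    qed
  qed
  have "fourier_mat k \<pi> A = kronecker_product (1\<^sub>m m) (\<pi> s\<^sub>2) * X"
  proof (rule eq_mat_blockI[of _ m k m])
    show "fourier_mat k \<pi> A \<in> carrier_mat (m * k) (m * k)"
      by (rule fourier_mat_carrier[OF A])
    show "kronecker_product (1\<^sub>m m) (\<pi> s\<^sub>2) * X \<in> carrier_mat (m * k) (m * k)"
      using kronecker_product_carrier[OF one_carrier_mat \<pi>_carrier[OF assms(7)]] X
      by (rule mult_carrier_mat)
    fix i j assume ij: "i < m" "j < m"
    show "block k (fourier_mat k \<pi> A) i j =
        block k (kronecker_product (1\<^sub>m m) (\<pi> s\<^sub>2) * X) i j"
      unfolding blocks[OF ij]
      by (rule block_kronecker_one_mult[symmetric, OF \<pi>_carrier[OF assms(7)] X ij])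
  qed
  then show ?thesis by (simp add: A_def X_def F_def mult.commute[of k m])
qed

end
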